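(* Let $X$ be a Fréchet space and $T:X\to X$ a continuous linear operator. The following conditions are equivalent: (i) there exist an increasing sequence of seminorms $(p_n)_{n\ge 1}$ defining the topology of $X$, a sequence of numbers $(C_n)_{n\ge 1}$ with $C_n\to\infty$, a sequence $(E_n)_{n\ge 1}$ of subspaces of $X$ of finite codimension and $N\ge 1$ such that for every $n\ge 1$, $p_N(T^nx)\ge C_n\,p_n(x)$ for any $x\in E_n$; (ii) there exist a sequence of seminorms $(p_n)_{n\ge 1}$ defining the topology of $X$ and $N\ge 1$ such that for every $n\ge 1$ there exist $C_n>1$, a subspace $E_n$ of $X$ of finite codimension and an integer $m_n\ge 1$ such that $p_N(T^{m_n}x)\ge C_n\,p_n(x)$ for any $x\in E_n$; (iii) there exist a sequence of seminorms $(p_n)_{n\ge 1}$ defining the topology of $X$ and $N\ge 1$ such that for every $n\ge 1$ there exist $C_n>1$, a subspace $E_n$ of $X$ of finite codimension and an integer $m_n\ge 1$ such that for any $x\in E_n$ there exists an integer $1\le k\le m_n$ for which $p_N(T^kx)\ge C_n\,p_n(x)$.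
   Context: Subspace means linear subspace (not required to be closed). An increasing sequence of seminorms means $p_n\le p_{n+1}$ pointwise for every $n$ (not necessarily strictly). Scalars are real or complex. *)

theory Defs
  imports "HOL-Analysis.Analysis"
begin

text \<open>
  The scalar field is a type of class \<open>real_normed_field\<close>.  Both \<open>real\<close> and \<open>complex\<close> are
  instances, and by Ostrowski's theorem they are the only ones up to isometric isomorphism.
  The space is a whole type, with its scalar multiplication passed as a parameter so that one
  statement covers both kinds of scalars.
\<close>

locale frechet_space = vector_space scl
  for scl :: "'k::real_normed_field \<Rightarrow> 'a::{ab_group_add, topological_space} \<Rightarrow> 'a" +
  assumes continuous_add: "continuous_on UNIV (\<lambda>(x, y). x + y :: 'a)"
    and continuous_scale: "continuous_on UNIV (\<lambda>(c, x). scl c x)"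
    and locally_convex: "\<And>U. open U \<Longrightarrow> 0 \<in> U \<Longrightarrow>
      \<exists>V. open V \<and> 0 \<in> V \<and> V \<subseteq> U \<and>
        (\<forall>x\<in>V. \<forall>y\<in>V. \<forall>t\<in>{0..1}. scl (of_real (1 - t)) x + scl (of_real t) y \<in> V)"
    and complete_metrizable: "\<exists>d. Metric_space (UNIV :: 'a set) d \<and>
      (\<forall>x y z. d (x + z) (y + z) = d x y) \<and>
      Metric_space.mtopology UNIV d = euclidean \<and>
      Metric_space.mcomplete UNIV d"

definition seminorm :: "('k::real_normed_field \<Rightarrow> 'a::ab_group_add \<Rightarrow> 'a) \<Rightarrow> ('a \<Rightarrow> real) \<Rightarrow> bool"
  where "seminorm scl p \<longleftrightarrow>
    (\<forall>x. 0 \<le> p x) \<and>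
    (\<forall>x y. p (x + y) \<le> p x + p y) \<and>
    (\<forall>c x. p (scl c x) = norm c * p x)"

text \<open>
  Sequences are indexed by \<open>n \<ge> 1\<close>; the value \<open>p 0\<close> is ignored.  The seminorms need not be
  increasing, so basic neighbourhoods are given by finitely many of them.
\<close>

definition defining_seminorms ::
    "('k::real_normed_field \<Rightarrow> 'a::{ab_group_add, topological_space} \<Rightarrow> 'a) \<Rightarrow>
      (nat \<Rightarrow> 'a \<Rightarrow> real) \<Rightarrow> bool"
  where "defining_seminorms scl p \<longleftrightarrow>
    (\<forall>n\<ge>1. seminorm scl (p n)) \<and>
    (\<forall>U. open U \<longleftrightarrow>
      (\<forall>x\<in>U. \<exists>F e. finite F \<and> F \<subseteq> {1..} \<and> 0 < e \<and> {y. \<forall>i\<in>F. p i (y - x) < e} \<subseteq> U))"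

definition increasing_seminorms :: "(nat \<Rightarrow> 'a \<Rightarrow> real) \<Rightarrow> bool"
  where "increasing_seminorms p \<longleftrightarrow> (\<forall>n\<ge>1. \<forall>x. p n x \<le> p (Suc n) x)"

text \<open>Finite codimension: the classes modulo \<open>E\<close> of the elements of \<open>F\<close> span the quotient by \<open>E\<close>.\<close>

definition finite_codim_subspace ::
    "('k::field \<Rightarrow> 'a::ab_group_add \<Rightarrow> 'a) \<Rightarrow> 'a set \<Rightarrow> bool"
  where "finite_codim_subspace scl E \<longleftrightarrow>
    module.subspace scl E \<and>
    (\<exists>F. finite F \<and> (\<forall>x. \<exists>y\<in>module.span scl F. x - y \<in> E))"

definition condition_i ::
    "('k::real_normed_field \<Rightarrow> 'a::{ab_group_add, topological_space} \<Rightarrow> 'a) \<Rightarrow> ('a \<Rightarrow> 'a) \<Rightarrow> bool"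
  where "condition_i scl T \<longleftrightarrow>
    (\<exists>(p :: nat \<Rightarrow> 'a \<Rightarrow> real) (C :: nat \<Rightarrow> real) (E :: nat \<Rightarrow> 'a set) (N :: nat).
      defining_seminorms scl p \<and> increasing_seminorms p \<and>
      filterlim C at_top sequentially \<and>
      (\<forall>n\<ge>1. finite_codim_subspace scl (E n)) \<and>
      N \<ge> 1 \<and>
      (\<forall>n\<ge>1. \<forall>x\<in>E n. p N ((T ^^ n) x) \<ge> C n * p n x))"

definition condition_ii ::
    "('k::real_normed_field \<Rightarrow> 'a::{ab_group_add, topological_space} \<Rightarrow> 'a) \<Rightarrow> ('a \<Rightarrow> 'a) \<Rightarrow> bool"
  where "condition_ii scl T \<longleftrightarrow>
    (\<exists>(p :: nat \<Rightarrow> 'a \<Rightarrow> real) (N :: nat).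
      defining_seminorms scl p \<and> N \<ge> 1 \<and>
      (\<forall>n\<ge>1. \<exists>(C :: real) (E :: 'a set) (m :: nat).
        C > 1 \<and> finite_codim_subspace scl E \<and> m \<ge> 1 \<and>
        (\<forall>x\<in>E. p N ((T ^^ m) x) \<ge> C * p n x)))"

definition condition_iii ::
    "('k::real_normed_field \<Rightarrow> 'a::{ab_group_add, topological_space} \<Rightarrow> 'a) \<Rightarrow> ('a \<Rightarrow> 'a) \<Rightarrow> bool"
  where "condition_iii scl T \<longleftrightarrow>
    (\<exists>(p :: nat \<Rightarrow> 'a \<Rightarrow> real) (N :: nat).
      defining_seminorms scl p \<and> N \<ge> 1 \<and>
      (\<forall>n\<ge>1. \<exists>(C :: real) (E :: 'a set) (m :: nat).
        C > 1 \<and> finite_codim_subspace scl E \<and> m \<ge> 1 \<and>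
        (\<forall>x\<in>E. \<exists>k. 1 \<le> k \<and> k \<le> m \<and> p N ((T ^^ k) x) \<ge> C * p n x)))"

end

theory Submission
  imports Defs
begin

text \<open>
  Only (iii) implies (i) needs work.  Apply (iii) to \<open>p N\<close> itself: on a subspace of finite
  codimension, \<open>p N (T^k x) \<ge> C * p N x\<close> for some \<open>1 \<le> k \<le> m\<close>.  With \<open>b > 1\<close> and \<open>b^m \<le> C\<close>, the
  continuous seminorm \<open>q x = max {p N (T^j x) / b^j | j < m}\<close> satisfies \<open>q (T x) \<ge> b * q x\<close> on that
  subspace, hence \<open>q (T^n x) \<ge> b^(n - m\<^sub>i) * p i x\<close> for all \<open>n \<ge> m\<^sub>i\<close> on subspaces depending on \<open>n\<close>
  and \<open>i\<close>.  It remains to let \<open>p i\<close> enter an increasing sequence of maxima starting at \<open>q\<close> so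
  late that \<open>m\<^sub>i \<le> n / 2\<close>.
\<close>

section \<open>Subspaces of finite codimension\<close>

context vector_space
begin

lemma finite_codim_subspace_UNIV: "finite_codim_subspace scale UNIV"
  unfolding finite_codim_subspace_def by (auto intro!: exI[of _ "{}"])

lemma finite_codim_subspace_vimage_Int:
  assumes T: "Vector_Spaces.linear scale scale T"
    and E: "finite_codim_subspace scale E" and G: "finite_codim_subspace scale G"
  shows "finite_codim_subspace scale (T -` E \<inter> G)"
proof -
  interpret T: Vector_Spaces.linear scale scale T by fact
  obtain F where sE: "subspace E" and F: "finite F" "\<And>x. \<exists>v\<in>span F. x - v \<in> E"
    using E unfolding finite_codim_subspace_def by blast
  obtain H where sG: "subspace G" and H: "finite H" "\<And>x. \<exists>y\<in>span H. x - y \<in> G"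
    using G unfolding finite_codim_subspace_def by blast
  \<comment> \<open>\<open>W\<close> collects the representatives in \<open>span F\<close> of the
    classes modulo \<open>E\<close> that \<open>T\<close> attains on \<open>G\<close>. Independent
    subsets of \<open>span F\<close> are finite, so finitely many preimages \<open>g b\<close>
    suffice.\<close>
  define W where "W = {v \<in> span F. \<exists>g\<in>G. T g - v \<in> E}"
  obtain B where B: "B \<subseteq> W" "independent B" "W \<subseteq> span B"
    using maximal_independent_subset[of W] by blast
  have "finite B"
    using independent_span_bound[OF F(1) B(2)] B(1) by (auto simp: W_def)
  have "\<forall>b\<in>B. \<exists>g. g \<in> G \<and> T g - b \<in> E"
    using B(1) by (auto simp: W_def)
  then obtain g where g: "\<And>b. b \<in> B \<Longrightarrow> g b \<in> G" "\<And>b. b \<in> B \<Longrightarrow> T (g b) - b \<in> E"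
    by metis
  have lift: "\<exists>z\<in>span (g ` B). T z - v \<in> E" if "v \<in> span B" for v
    using that
  proof (induction rule: span_induct_alt)
    case base
    then show ?case
      using subspace_0[OF sE] by (intro bexI[of _ 0]) (auto simp: T.zero span_zero)
  next
    case (step c b v)
    then obtain z where z: "z \<in> span (g ` B)" "T z - v \<in> E"
      by blast
    have "scale c (g b) + z \<in> span (g ` B)"
      using step(1) z(1) by (intro span_add span_scale) (auto intro: span_base)
    moreover have "T (scale c (g b) + z) - (scale c b + v)
        = scale c (T (g b) - b) + (T z - v)"
      by (simp add: T.add T.scale scale_right_diff_distrib algebra_simps)
    moreover have "scale c (T (g b) - b) + (T z - v) \<in> E"
      using subspace_add[OF sE subspace_scale[OF sE g(2)[OF step(1)]] z(2)] .
    ultimately show ?case by metis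
  qed
  have gG: "span (g ` B) \<subseteq> G"
    using g(1) sG by (intro span_minimal) auto
  \<comment> \<open>Two corrections: \<open>y\<close> moves \<open>x\<close> into \<open>G\<close>,
    then \<open>z\<close> moves \<open>T (x - y)\<close> into \<open>E\<close>. The second preserves
    the first because \<open>z\<close> is itself in \<open>G\<close>.\<close>
  have "\<exists>w\<in>span (H \<union> g ` B). x - w \<in> T -` E \<inter> G" for x
  proof -
    obtain y where y: "y \<in> span H" "x - y \<in> G" using H(2) by blast
    obtain v where v: "v \<in> span F" "T (x - y) - v \<in> E" using F(2) by blast
    have "v \<in> span B" using B(3) v y(2) by (auto simp: W_def)
    then obtain z where z: "z \<in> span (g ` B)" "T z - v \<in> E" using lift by blast
    have "T (x - (y + z)) = (T (x - y) - v) - (T z - v)"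
      by (simp add: T.add T.diff algebra_simps)
    then have "T (x - (y + z)) \<in> E"
      using subspace_diff[OF sE v(2) z(2)] by simp
    moreover have "x - (y + z) \<in> G"
      using subspace_diff[OF sG y(2), of z] gG z(1) by (auto simp: algebra_simps)
    moreover have "y + z \<in> span (H \<union> g ` B)"
      using y(1) z(1) span_mono[of H "H \<union> g ` B"] span_mono[of "g ` B" "H \<union> g ` B"]
      by (intro span_add) auto
    ultimately show ?thesis by blast
  qed
  moreover have "subspace (T -` E \<inter> G)"
    using sG T.subspace_vimage[OF sE] by (intro subspace_inter)
  moreover have "finite (H \<union> g ` B)"
    using H(1) \<open>finite B\<close> by simp
  ultimately show ?thesis
    unfolding finite_codim_subspace_def by blast
qed

lemma finite_codim_subspace_INT:
  assumes "finite I" "\<And>i. i \<in> I \<Longrightarrow> finite_codim_subspace scale (E i)"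
  shows "finite_codim_subspace scale (\<Inter>i\<in>I. E i)"
  using assms
proof (induction rule: finite_induct)
  case empty
  then show ?case by (simp add: finite_codim_subspace_UNIV)
next
  case (insert i I)
  then show ?case
    using finite_codim_subspace_vimage_Int[OF linear_id, of "E i" "\<Inter>i\<in>I. E i"] by simp
qed

lemma linear_funpow:
  assumes "Vector_Spaces.linear scale scale T"
  shows "Vector_Spaces.linear scale scale (T ^^ n)"
proof (induction n)
  case 0
  then show ?case using linear_id by (simp add: id_def)
next
  case (Suc n)
  then show ?case
    using Vector_Spaces.linear_compose[OF Suc assms] by (simp add: comp_def)
qed

end

section \<open>Seminorms\<close>

lemma seminorm_zero:
  assumes "vector_space scl" "seminorm scl p"
  shows "p 0 = 0"
proof -
  interpret vector_space scl by fact
  have "p (scl 0 0) = norm (0 :: 'a) * p 0"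
    using assms(2) unfolding seminorm_def by blast
  then show ?thesis by simp
qed

lemma seminorm_compose_linear:
  assumes "Vector_Spaces.linear scl scl T" "seminorm scl p"
  shows "seminorm scl (\<lambda>x. p (T x))"
proof -
  interpret T: Vector_Spaces.linear scl scl T by fact
  show ?thesis
    using assms(2) by (simp add: seminorm_def T.add T.scale)
qed

lemma seminorm_divide:
  assumes "seminorm scl p" "0 < r"
  shows "seminorm scl (\<lambda>x. p x / r)"
  using assms unfolding seminorm_def
  by (simp add: divide_right_mono flip: add_divide_distrib)

lemma seminorm_Max:
  assumes "finite I" "I \<noteq> {}" "\<And>i. i \<in> I \<Longrightarrow> seminorm scl (f i)"
  shows "seminorm scl (\<lambda>x. MAX i\<in>I. f i x)"
  unfolding seminorm_def
proof (intro conjI allI)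
  fix x y c
  have le: "f i z \<le> (MAX i\<in>I. f i z)" if "i \<in> I" for i z
    using that assms(1) by simp
  have f: "0 \<le> f i x" "f i (x + y) \<le> f i x + f i y" "f i (scl c x) = norm c * f i x"
    if "i \<in> I" for i
    using assms(3)[OF that] unfolding seminorm_def by blast+
  obtain i where "i \<in> I" using assms(2) by blast
  then show "0 \<le> (MAX i\<in>I. f i x)"
    using f(1) le order_trans by blast
  have "f i (x + y) \<le> (MAX i\<in>I. f i x) + (MAX i\<in>I. f i y)" if "i \<in> I" for i
    using f(2)[OF that] le[OF that, of x] le[OF that, of y] by linarith
  then show "(MAX i\<in>I. f i (x + y)) \<le> (MAX i\<in>I. f i x) + (MAX i\<in>I. f i y)"
    using assms(1,2) by simp
  have "(MAX i\<in>I. f i (scl c x)) = (MAX i\<in>I. norm c * f i x)"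
    using f(3) by (simp cong: image_cong_simp)
  also have "\<dots> = norm c * (MAX i\<in>I. f i x)"
    using mono_Max_commute[of "\<lambda>t. norm c * t" "(\<lambda>i. f i x) ` I"] assms(1,2)
    by (simp add: mono_def mult_left_mono image_image)
  finally show "(MAX i\<in>I. f i (scl c x)) = norm c * (MAX i\<in>I. f i x)" .
qed

text \<open>Openness of the sets \<open>{x. f x < e}\<close> serves throughout as the form of
  continuity of a seminorm. It passes to a finite maximum because the sublevel set of the maximum is
  the intersection of the sublevel sets.\<close>

lemma open_Max_less:
  fixes f :: "'i \<Rightarrow> 'a::topological_space \<Rightarrow> real"
  assumes "finite I" "I \<noteq> {}" "\<And>i. i \<in> I \<Longrightarrow> open {x. f i x < e}"
  shows "open {x. (MAX i\<in>I. f i x) < e}"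
proof -
  have "{x. (MAX i\<in>I. f i x) < e} = (\<Inter>i\<in>I. {x. f i x < e})"
    using assms(1,2) by auto
  then show ?thesis
    using assms by auto
qed

lemma open_defining_seminorm_less:
  assumes "defining_seminorms scl p" "n \<ge> 1"
  shows "open {x. p n x < e}"
proof -
  have add: "p n (x + y) \<le> p n x + p n y" for x y
    using assms unfolding defining_seminorms_def seminorm_def by blast
  have "\<exists>F d. finite F \<and> F \<subseteq> {1..} \<and> 0 < d \<and> {y. \<forall>i\<in>F. p i (y - x) < d} \<subseteq> {x. p n x < e}"
    if "p n x < e" for x
  proof (intro exI[of _ "{n}"] exI[of _ "e - p n x"] conjI subsetI)
    fix y assume "y \<in> {y. \<forall>i\<in>{n}. p i (y - x) < e - p n x}"
    then show "y \<in> {x. p n x < e}"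
      using add[of "y - x" x] by simp
  qed (use that assms(2) in auto)
  then show ?thesis
    using assms(1) unfolding defining_seminorms_def by blast
qed

text \<open>By \<open>dom\<close> every \<open>p\<close>-ball contains an \<open>r\<close>-ball, and
  by \<open>cont\<close> every \<open>r\<close>-ball contains a \<open>p\<close>-ball, so both
  families define the same topology.\<close>

lemma defining_seminorms_equivalent:
  assumes vs: "vector_space scl" and p: "defining_seminorms scl p"
    and r: "\<And>n. n \<ge> 1 \<Longrightarrow> seminorm scl (r n)"
    and cont: "\<And>n e. n \<ge> 1 \<Longrightarrow> open {x. r n x < e}"
    and dom: "\<And>i. i \<ge> 1 \<Longrightarrow> \<exists>j\<ge>1. \<forall>x. p i x \<le> r j x"
  shows "defining_seminorms scl r"
proof -
  have op: "open U \<longleftrightarrow>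
      (\<forall>x\<in>U. \<exists>F e. finite F \<and> F \<subseteq> {1..} \<and> 0 < e \<and> {y. \<forall>i\<in>F. p i (y - x) < e} \<subseteq> U)" for U
    using p unfolding defining_seminorms_def by blast
  have ball: "\<exists>F e. finite F \<and> F \<subseteq> {1..} \<and> 0 < e \<and> {y. \<forall>i\<in>F. p i (y - x) < e} \<subseteq> U"
    if "open U" "x \<in> U" for x U
    using iffD1[OF op that(1)] that(2) by (rule bspec)
  have "\<forall>i\<in>{1..}. \<exists>j. j \<ge> 1 \<and> (\<forall>x. p i x \<le> r j x)"
    using dom by simp
  from bchoice[OF this] obtain j where "\<forall>i\<in>{1..}. j i \<ge> 1 \<and> (\<forall>x. p i x \<le> r (j i) x)" ..
  then have j: "\<And>i. i \<ge> 1 \<Longrightarrow> j i \<ge> 1" "\<And>i x. i \<ge> 1 \<Longrightarrow> p i x \<le> r (j i) x"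
    by simp_all
  have "open U \<longleftrightarrow>
      (\<forall>x\<in>U. \<exists>F e. finite F \<and> F \<subseteq> {1..} \<and> 0 < e \<and> {y. \<forall>i\<in>F. r i (y - x) < e} \<subseteq> U)" for U
  proof
    assume "open U"
    show "\<forall>x\<in>U. \<exists>F e. finite F \<and> F \<subseteq> {1..} \<and> 0 < e \<and> {y. \<forall>i\<in>F. r i (y - x) < e} \<subseteq> U"
    proof
      fix x assume "x \<in> U"
      from ball[OF \<open>open U\<close> this] obtain F e
        where F: "finite F" "F \<subseteq> {1..}" "0 < e" "{y. \<forall>i\<in>F. p i (y - x) < e} \<subseteq> U"
        by (elim exE conjE) (rule that)
      have "p i (y - x) < e" if "\<forall>i\<in>j ` F. r i (y - x) < e" "i \<in> F" for y i
      proof -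
        have "p i (y - x) \<le> r (j i) (y - x)"
          using j(2)[of i] F(2) that(2) by auto
        then show ?thesis
          using that by fastforce
      qed
      then have "{y. \<forall>i\<in>j ` F. r i (y - x) < e} \<subseteq> {y. \<forall>i\<in>F. p i (y - x) < e}"
        by blast
      then have "{y. \<forall>i\<in>j ` F. r i (y - x) < e} \<subseteq> U"
        using F(4) by (rule subset_trans)
      moreover have "finite (j ` F)" "j ` F \<subseteq> {1..}"
        using F(1,2) j(1) by auto
      ultimately show "\<exists>F e. finite F \<and> F \<subseteq> {1..} \<and> 0 < e \<and> {y. \<forall>i\<in>F. r i (y - x) < e} \<subseteq> U"
        using F(3) by (intro exI conjI)
    qed
  next
    assume R: "\<forall>x\<in>U. \<exists>F e. finite F \<and> F \<subseteq> {1..} \<and> 0 < e \<and> {y. \<forall>i\<in>F. r i (y - x) < e} \<subseteq> U"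
    have "\<exists>F e. finite F \<and> F \<subseteq> {1..} \<and> 0 < e \<and> {y. \<forall>i\<in>F. p i (y - x) < e} \<subseteq> U"
      if "x \<in> U" for x
    proof -
      from bspec[OF R \<open>x \<in> U\<close>] obtain F e
        where F: "finite F" "F \<subseteq> {1..}" "0 < e" "{y. \<forall>i\<in>F. r i (y - x) < e} \<subseteq> U"
        by (elim exE conjE) (rule that)
      \<comment> \<open>Continuity of the \<open>r i\<close> is used at \<open>0\<close> only; the
        resulting \<open>p\<close>-ball is then translated to \<open>x\<close>.\<close>
      have "open (\<Inter>i\<in>F. {z. r i z < e})"
        using F cont by (intro open_INT) auto
      moreover have "0 \<in> (\<Inter>i\<in>F. {z. r i z < e})"
        using F seminorm_zero[OF vs r] by auto
      ultimately have "\<exists>G d. finite G \<and> G \<subseteq> {1..} \<and> 0 < d \<and>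
          {z. \<forall>i\<in>G. p i (z - 0) < d} \<subseteq> (\<Inter>i\<in>F. {z. r i z < e})"
        by (rule ball)
      then obtain G d where G: "finite G" "G \<subseteq> {1..}" "0 < d"
          "{z. \<forall>i\<in>G. p i (z - 0) < d} \<subseteq> (\<Inter>i\<in>F. {z. r i z < e})"
        by (elim exE conjE) (rule that)
      have "y \<in> U" if "\<forall>i\<in>G. p i (y - x) < d" for y
      proof -
        have "y - x \<in> (\<Inter>i\<in>F. {z. r i z < e})"
          using that by (intro subsetD[OF G(4)]) simp
        then show ?thesis
          by (intro subsetD[OF F(4)]) simp
      qed
      then have "{y. \<forall>i\<in>G. p i (y - x) < d} \<subseteq> U"
        by blast
      with G(1-3) show ?thesis
        by (intro exI conjI)
    qed
    then show "open U" by (intro iffD2[OF op] ballI)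
  qed
  then show ?thesis
    using r unfolding defining_seminorms_def by (intro conjI allI impI)
qed

section \<open>The expanding seminorm\<close>

text \<open>\<open>?R / b\<close> is the maximum of \<open>p ((T ^^ j) x) / b ^ j\<close> over
  \<open>1 \<le> j \<le> m\<close>, and \<open>?L\<close> is the same maximum over
  \<open>0 \<le> j < m\<close>. Only the term \<open>j = 0\<close> leaves the window, and the term
  \<open>j = k\<close> dominates it since \<open>b ^ k \<le> C\<close>.\<close>

lemma MAX_funpow_expanding:
  fixes p :: "'a \<Rightarrow> real"
  assumes nonneg: "\<And>x. 0 \<le> p x" and b: "1 \<le> b" "b ^ m \<le> C"
    and k: "1 \<le> k" "k \<le> m" "p ((T ^^ k) x) \<ge> C * p x"
  shows "(MAX j\<in>{..<m}. p ((T ^^ j) (T x)) / b ^ j)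
    \<ge> b * (MAX j\<in>{..<m}. p ((T ^^ j) x) / b ^ j)" (is "?R \<ge> b * ?L")
proof -
  have step: "p ((T ^^ j) x) / b ^ j \<le> ?R / b" if "1 \<le> j" "j \<le> m" for j
  proof -
    obtain i where i: "j = Suc i" using \<open>1 \<le> j\<close> by (cases j) auto
    have "p ((T ^^ i) (T x)) / b ^ i \<le> ?R"
      using that i by (intro Max_ge) auto
    then have "p ((T ^^ i) (T x)) / b ^ i / b \<le> ?R / b"
      using b(1) by (intro divide_right_mono) auto
    then show ?thesis
      by (simp add: i funpow_swap1 mult.commute)
  qed
  have "b ^ k \<le> C"
    using b power_increasing[OF k(2) b(1)] by simp
  then have "b ^ k * p x \<le> p ((T ^^ k) x)"
    using k(3) mult_right_mono[OF _ nonneg] by (meson order_trans)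
  then have "p x \<le> p ((T ^^ k) x) / b ^ k"
    using b(1) by (simp add: field_simps)
  then have zero: "p x \<le> ?R / b"
    using step[OF k(1,2)] by simp
  have "p ((T ^^ j) x) / b ^ j \<le> ?R / b" if "j < m" for j
    using zero step[of j] that by (cases j) auto
  then have "?L \<le> ?R / b"
    using k(1,2) by (subst Max_le_iff) (auto simp: lessThan_empty_iff)
  then show ?thesis
    using b(1) by (simp add: field_simps)
qed

text \<open>Expansion is known on \<open>E\<close> alone, and \<open>E\<close> need not be
  invariant, so the first \<open>n\<close> points of the orbit have to lie in \<open>E\<close>. This
  is what forces subspaces depending on \<open>n\<close>.\<close>

lemma funpow_expanding:
  fixes q :: "'a \<Rightarrow> real"
  assumes "\<And>x. x \<in> E \<Longrightarrow> q (T x) \<ge> b * q x" "0 \<le> b" "\<And>i. i < n \<Longrightarrow> (T ^^ i) x \<in> E"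
  shows "q ((T ^^ n) x) \<ge> b ^ n * q x"
  using assms(3)
proof (induction n)
  case (Suc n)
  have "b * (b ^ n * q x) \<le> b * q ((T ^^ n) x)"
    using Suc assms(2) by (intro mult_left_mono) auto
  also have "\<dots> \<le> q (T ((T ^^ n) x))"
    using Suc.prems assms(1) by blast
  finally show ?case by (simp add: mult.assoc)
qed simp

section \<open>The equivalences\<close>

text \<open>\<open>C n\<close> itself may be at most \<open>1\<close>. For large
  \<open>m \<ge> n\<close>, however, \<open>C m > 1\<close>, and the estimate for \<open>p m\<close>
  passes to the smaller \<open>p n\<close>.\<close>

lemma condition_i_imp_ii:
  assumes "condition_i scl T"
  shows "condition_ii scl T"
proof -
  obtain p C E N where p: "defining_seminorms scl p" "increasing_seminorms p"
    and C: "filterlim C at_top sequentially" and N: "N \<ge> 1"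
    and E: "\<And>n. n \<ge> 1 \<Longrightarrow> finite_codim_subspace scl (E n)"
    and ineq: "\<And>n x. n \<ge> 1 \<Longrightarrow> x \<in> E n \<Longrightarrow> p N ((T ^^ n) x) \<ge> C n * p n x"
    using assms unfolding condition_i_def by blast
  have "\<exists>(C :: real) (E :: 'b set) (m :: nat). C > 1 \<and> finite_codim_subspace scl E \<and> m \<ge> 1 \<and>
        (\<forall>x\<in>E. p N ((T ^^ m) x) \<ge> C * p n x)" if n: "n \<ge> 1" for n
  proof -
    have "eventually (\<lambda>m. m \<ge> n \<and> C m > 1) sequentially"
      using C by (intro eventually_conj eventually_ge_at_top) (auto simp: filterlim_at_top_dense)
    then obtain m where m: "m \<ge> n" "C m > 1"
      by (auto simp: eventually_sequentially)
    have mono: "p n x \<le> p m x" for x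
      using m(1)
    proof (induction m rule: dec_induct)
      case (step k)
      then show ?case
        using p(2) n unfolding increasing_seminorms_def by (meson order_trans)
    qed simp
    have "C m * p n x \<le> p N ((T ^^ m) x)" if "x \<in> E m" for x
    proof -
      have "C m * p n x \<le> C m * p m x"
        using m(2) mono by (intro mult_left_mono) auto
      also have "\<dots> \<le> p N ((T ^^ m) x)"
        using that m n by (intro ineq) auto
      finally show ?thesis .
    qed
    then show ?thesis
      using m n E[of m] by (intro exI[of _ "C m"] exI[of _ "E m"] exI[of _ m]) auto
  qed
  then show ?thesis
    unfolding condition_ii_def using p N by blast
qed

lemma condition_ii_imp_iii:
  assumes "condition_ii scl T"
  shows "condition_iii scl T"
proof -
  obtain p N where p: "defining_seminorms scl p" "N \<ge> 1"
    and ex: "\<forall>n\<ge>1. \<exists>(C :: real) E (m :: nat). C > 1 \<and> finite_codim_subspace scl E \<and> m \<ge> 1 \<and>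
        (\<forall>x\<in>E. p N ((T ^^ m) x) \<ge> C * p n x)"
    using assms unfolding condition_ii_def by blast
  have "\<exists>(C :: real) E (m :: nat). C > 1 \<and> finite_codim_subspace scl E \<and> m \<ge> 1 \<and>
        (\<forall>x\<in>E. \<exists>k. 1 \<le> k \<and> k \<le> m \<and> p N ((T ^^ k) x) \<ge> C * p n x)" if n: "n \<ge> 1" for n
  proof -
    obtain C E m where "C > 1" "finite_codim_subspace scl E" "m \<ge> 1"
        "\<And>x. x \<in> E \<Longrightarrow> p N ((T ^^ m) x) \<ge> C * p n x"
      using ex n by blast
    then show ?thesis
      by (intro exI[of _ C] exI[of _ E] exI[of _ m]) auto
  qed
  then show ?thesis
    unfolding condition_iii_def using p by blast
qed

lemma condition_iii_imp_i:
  fixes scl :: "'k::real_normed_field \<Rightarrow> 'a::{ab_group_add, topological_space} \<Rightarrow> 'a"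
  assumes T: "Vector_Spaces.linear scl scl T" and contT: "continuous_on UNIV T"
    and "condition_iii scl T"
  shows "condition_i scl T"
proof -
  interpret T: Vector_Spaces.linear scl scl T by fact
  note vs = T.vs1.vector_space_axioms
  obtain p N where p: "defining_seminorms scl p" and N: "N \<ge> 1"
    and ex: "\<forall>n\<ge>1. \<exists>(C :: real) (E :: 'a set) (m :: nat).
        C > 1 \<and> finite_codim_subspace scl E \<and> m \<ge> 1 \<and>
        (\<forall>x\<in>E. \<exists>k. 1 \<le> k \<and> k \<le> m \<and> p N ((T ^^ k) x) \<ge> C * p n x)"
    using assms(3) unfolding condition_iii_def by blast
  obtain C E m where C: "\<And>n. n \<ge> 1 \<Longrightarrow> C n > (1::real)"
    and E: "\<And>n. n \<ge> 1 \<Longrightarrow> finite_codim_subspace scl (E n)"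
    and m: "\<And>n. n \<ge> 1 \<Longrightarrow> m n \<ge> (1::nat)"
    and ret: "\<And>n x. n \<ge> 1 \<Longrightarrow> x \<in> E n \<Longrightarrow>
        \<exists>k. 1 \<le> k \<and> k \<le> m n \<and> p N ((T ^^ k) x) \<ge> C n * p n x"
    using ex by metis
  have sp: "seminorm scl (p n)" if "n \<ge> 1" for n
    using p that unfolding defining_seminorms_def by blast
  then have nonneg: "0 \<le> p n x" if "n \<ge> 1" for n x
    using that unfolding seminorm_def by blast

  \<comment> \<open>The factor \<open>2\<close> makes \<open>b\<close> a square: \<open>q\<close>
    expands at rate \<open>b\<close>, but only rate \<open>c = sqrt b\<close> is claimed. If at most
    half of the \<open>n\<close> steps are spent waiting, the others still yield
    \<open>c ^ n\<close>.\<close>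
  define c where "c = root (2 * m N) (C N)"
  have c: "c > 1" "c ^ (2 * m N) = C N"
    using C[OF N] m[OF N] by (auto simp: c_def intro!: real_root_pow_pos2)
  define b where "b = c\<^sup>2"
  have b: "b > 1" "b ^ m N \<le> C N"
    using c by (auto simp: b_def simp flip: power_mult)
  define q where "q x = (MAX j\<in>{..<m N}. p N ((T ^^ j) x) / b ^ j)" for x
  have ne: "{..<m N} \<noteq> {}"
    using m[OF N] by (auto simp: lessThan_empty_iff)
  have sq: "seminorm scl q"
    unfolding q_def
  proof (intro seminorm_Max ne)
    fix j
    have "seminorm scl (\<lambda>x. p N ((T ^^ j) x))"
      using seminorm_compose_linear[OF T.vs1.linear_funpow[OF T] sp[OF N]] .
    then show "seminorm scl (\<lambda>x. p N ((T ^^ j) x) / b ^ j)"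
      using seminorm_divide b(1) by fastforce
  qed simp
  have contq: "open {x. q x < e}" for e
    unfolding q_def
  proof (intro open_Max_less ne)
    fix j
    have "continuous_on UNIV (T ^^ j)"
    proof (induction j)
      case (Suc j)
      then show ?case
        using continuous_on_compose[OF Suc continuous_on_subset[OF contT]] by simp
    qed (simp add: id_def)
    then have "open ((T ^^ j) -` {z. p N z < e * b ^ j})"
      using open_vimage open_defining_seminorm_less[OF p N] by blast
    also have "(T ^^ j) -` {z. p N z < e * b ^ j} = {x. p N ((T ^^ j) x) / b ^ j < e}"
      using b(1) by (auto simp: pos_divide_less_eq)
    finally show "open {x. p N ((T ^^ j) x) / b ^ j < e}" .
  qed simp
  have q_ge: "p N x \<le> q x" for x
  proof -
    have "p N ((T ^^ 0) x) / b ^ 0 \<le> q x"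
      unfolding q_def using m[OF N] by (intro Max_ge finite_imageI imageI) auto
    then show ?thesis by simp
  qed
  have q_nonneg: "0 \<le> q x" for x
    using q_ge nonneg[OF N] by (meson order_trans)
  have q_step: "q (T x) \<ge> b * q x" if x: "x \<in> E N" for x
  proof -
    obtain k where "1 \<le> k" "k \<le> m N" "p N ((T ^^ k) x) \<ge> C N * p N x"
      using ret[OF N x] by blast
    then show ?thesis
      unfolding q_def using b nonneg[OF N] by (intro MAX_funpow_expanding) auto
  qed
  have q_pow: "q ((T ^^ n) x) \<ge> b ^ n * q x" if "\<And>i. i < n \<Longrightarrow> (T ^^ i) x \<in> E N" for n x
    using q_step b(1) that by (intro funpow_expanding[where E = "E N"]) auto

  define A where "A n = {i. 1 \<le> i \<and> i \<le> n \<and> 2 * m i \<le> n}" for n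
  have finA: "finite (A n)" for n
    by (rule finite_subset[of _ "{..n}"]) (auto simp: A_def)
  \<comment> \<open>The index \<open>0\<close>, never a member of \<open>A n\<close>, stands for \<open>q\<close>.\<close>
  define f where "f i = (if i = 0 then q else p i)" for i
  define r where "r n x = (MAX i\<in>insert 0 (A n). f i x)" for n x
  have f0: "f 0 = q"
    by (simp add: f_def)
  have fA: "f i = p i" if "i \<in> A n" for i n
    using that by (auto simp: f_def A_def)
  have A1: "i \<ge> 1" if "i \<in> A n" for i n
    using that by (simp add: A_def)
  have r1: "r 1 = q"
  proof -
    have "A 1 = {}" using m by (force simp: A_def)
    then show ?thesis by (simp add: r_def fun_eq_iff f_def)
  qed
  have r_mono: "r n x \<le> r (Suc n) x" for n x
    unfolding r_def using finA
    by (intro Max_mono image_mono) (auto simp: A_def)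
  have dr: "defining_seminorms scl r"
  proof (rule defining_seminorms_equivalent[OF vs p])
    show "seminorm scl (r n)" for n
      unfolding r_def using finA sq sp by (intro seminorm_Max) (auto simp: f_def A_def)
    show "open {x. r n x < e}" for n e
      unfolding r_def using finA contq open_defining_seminorm_less[OF p]
      by (intro open_Max_less) (auto simp: f_def A_def)
    show "\<exists>j\<ge>1. \<forall>x. p i x \<le> r j x" if i: "i \<ge> 1" for i
    proof (intro exI[of _ "i + 2 * m i"] conjI allI)
      have "i \<in> A (i + 2 * m i)" using i by (simp add: A_def)
      then show "p i x \<le> r (i + 2 * m i) x" for x
        unfolding r_def using finA fA by (intro Max_ge) (auto intro!: image_eqI[of _ _ i])
    qed (use i in simp)
  qed

  define G where "G n = (\<Inter>i\<in>{..<n}. (T ^^ i) -` E N) \<inter> (\<Inter>i\<in>A n. E i)" for n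
  have "finite_codim_subspace scl (G n)" for n
  proof -
    have "finite_codim_subspace scl ((T ^^ i) -` E N)" for i
      using T.vs1.finite_codim_subspace_vimage_Int[OF T.vs1.linear_funpow[OF T] E[OF N]
          T.vs1.finite_codim_subspace_UNIV] by simp
    then have "finite_codim_subspace scl (\<Inter>i\<in>{..<n}. (T ^^ i) -` E N)"
      by (intro T.vs1.finite_codim_subspace_INT) auto
    moreover have "finite_codim_subspace scl (\<Inter>i\<in>A n. E i)"
      using finA E A1 by (intro T.vs1.finite_codim_subspace_INT) auto
    ultimately show ?thesis
      using T.vs1.finite_codim_subspace_vimage_Int[OF T.vs1.linear_id] unfolding G_def by simp
  qed
  moreover have "r 1 ((T ^^ n) x) \<ge> c ^ n * r n x" if x: "x \<in> G n" for n x
  proof -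
    have orbit: "(T ^^ i) x \<in> E N" if "i < n" for i
      using x that by (auto simp: G_def)
    have "c ^ n * p i x \<le> q ((T ^^ n) x)" if i: "i \<in> A n" for i
    proof -
      have "x \<in> E i" using x i by (auto simp: G_def)
      then obtain k where k: "k \<le> m i" "p N ((T ^^ k) x) \<ge> C i * p i x"
        using ret A1[OF i] by blast
      have kn: "n \<le> 2 * (n - k)" "k \<le> n" using k(1) i by (auto simp: A_def)
      \<comment> \<open>The return at time \<open>k\<close> serves to compare \<open>p i x\<close>
        with \<open>q ((T ^^ k) x)\<close>; the growth comes from applying \<open>q_pow\<close> to
        the remaining \<open>n - k\<close> steps.\<close>
      have "p i x \<le> C i * p i x"
        using C[OF A1[OF i]] nonneg[OF A1[OF i], of x] by (simp add: mult_le_cancel_right1)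
      then have le: "p i x \<le> q ((T ^^ k) x)"
        using k(2) q_ge[of "(T ^^ k) x"] by linarith
      have "c ^ n \<le> c ^ (2 * (n - k))"
        using c(1) kn(1) by (intro power_increasing) auto
      also have "\<dots> = b ^ (n - k)"
        by (simp add: b_def power_mult)
      finally have "c ^ n * p i x \<le> b ^ (n - k) * q ((T ^^ k) x)"
        using le nonneg[OF A1[OF i]] b(1) by (intro mult_mono) auto
      also have "\<dots> \<le> q ((T ^^ (n - k)) ((T ^^ k) x))"
      proof (rule q_pow)
        \<comment> \<open>The orbit now starts at \<open>(T ^^ k) x\<close>, but its indices
          \<open>l + k\<close> stay below \<open>n\<close>, within the range controlled by
          \<open>G n\<close>.\<close>
        fix l assume "l < n - k"
        then show "(T ^^ l) ((T ^^ k) x) \<in> E N"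
          using orbit[of "l + k"] by (simp add: funpow_add)
      qed
      also have "(T ^^ (n - k)) ((T ^^ k) x) = (T ^^ n) x"
        using kn(2) funpow_add[of "n - k" k T] by simp
      finally show ?thesis .
    qed
    moreover have "c ^ n * q x \<le> q ((T ^^ n) x)"
    proof -
      \<comment> \<open>For \<open>q\<close> itself there is no waiting time, so all
        \<open>n\<close> steps expand at rate \<open>b \<ge> c\<close>.\<close>
      have "c ^ n \<le> b ^ n"
        using c(1) by (auto simp: b_def power_mono self_le_power)
      then have "c ^ n * q x \<le> b ^ n * q x"
        using q_nonneg by (intro mult_right_mono) auto
      then show ?thesis using q_pow[of n x] orbit by auto
    qed
    ultimately have "f i x \<le> q ((T ^^ n) x) / c ^ n" if "i \<in> insert 0 (A n)" for i
      using that c(1) f0 fA by (auto simp: pos_le_divide_eq mult.commute)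
    then have "r n x \<le> q ((T ^^ n) x) / c ^ n"
      unfolding r_def using finA by (subst Max_le_iff) auto
    then show ?thesis
      using c(1) by (simp add: r1[simplified] pos_le_divide_eq mult.commute)
  qed
  moreover have "filterlim (\<lambda>n. c ^ n) at_top sequentially"
    using c(1)
    by (intro filterlim_at_infinity_imp_filterlim_at_top filterlim_realpow_sequentially_gt1) auto
  moreover have "increasing_seminorms r"
    using r_mono unfolding increasing_seminorms_def by blast
  ultimately show ?thesis
    unfolding condition_i_def using dr
    by (intro exI[of _ r] exI[of _ "\<lambda>n. c ^ n"] exI[of _ G] exI[of _ "1::nat"]) auto
qed

theorem theorem2p2:
  fixes scl :: "'k::real_normed_field \<Rightarrow> 'a::{ab_group_add, topological_space} \<Rightarrow> 'a"
    and T :: "'a \<Rightarrow> 'a"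
  assumes "frechet_space scl"
    and "Vector_Spaces.linear scl scl T"
    and "continuous_on UNIV T"
  shows "(condition_i scl T \<longleftrightarrow> condition_ii scl T) \<and>
         (condition_ii scl T \<longleftrightarrow> condition_iii scl T)"
  using condition_i_imp_ii[of scl T] condition_ii_imp_iii[of scl T]
    condition_iii_imp_i[OF assms(2,3)] by argo

end
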